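(* Let $(W,S)$ be an extended Weyl system of domestic or wild type acting on the extended space $V$, and let $(\tilde W,\tilde S)$ be its hyperbolic cover. Then the group $\tilde W$ acts faithfully on $V$, and $\tilde W$ is isomorphic to $W$.
   Context: Extended Coxeter-Dynkin diagram: given integers $r\ge0$ and $p_1,\ldots,p_r\ge1$, the vertex set is $Q=\{1,1^*\}\cup\{(i,j)\mid1\le i\le r,1\le j\le p_i\}$. Single edges join $(i,j)$ and $(i,j+1)$ for $1\le j<p_i$, $1$ and $(i,1)$, and $1^*$ and $(i,1)$. The vertices $1,1^*$ are joined by a dotted double bond. $V$ is the real vector space with basis $B=\{\alpha_\nu\mid\nu\in Q\}$ and symmetric bilinear form with $(\alpha_\nu\mid\alpha_\nu)=2=(\alpha_1\mid\alpha_{1^*})$, $-1$ for vertices joined by a single edge, $0$ otherwise. For $(\alpha\mid\alpha)\ne0$, $s_\alpha(v)=v-\frac{2(\alpha\mid v)}{(\alpha\mid\alpha)}\alpha$. $S=\{s_\alpha\mid\alpha\in B\}$ and $W=\langle S\rangle\le\mathrm{GL}(V)$. $W$ is wild if the signature (positive, negative, zero) of the form is $(|B|-2,1,1)$, and domestic if it is $(|B|-1,0,1)$. Hyperbolic cover (domestic or wild type): let $a=\alpha_{1^*}-\alpha_1$, which spans the radical of the form, and $\overline V=\mathrm{span}_{\mathbb R}(B\setminus\{\alpha_{1^*}\})$. Let $\tilde V=V\oplus\mathbb Ra'$ with the form extended by $(\overline V\mid a')=0$, $(a\mid a')=1$, $(a'\mid a')=0$. For $\alpha\in B$ let $\tilde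 s_\alpha$ be the reflection of $\tilde V$ with respect to $\alpha$ (same formula, on $\tilde V$). Then $\tilde S=\{\tilde s_\alpha\mid\alpha\in B\}$ and $\tilde W=\langle\tilde S\rangle\le\mathrm{GL}(\tilde V)$; $\tilde W$ preserves $V$. *)

theory Defs
  imports "HOL-Analysis.Finite_Function_Topology" "HOL-Algebra.Group_Action" "HOL-Algebra.Generated_Groups"
begin

section \<open>Linear groups of subspaces, generated by reflections\<close>

text \<open>As in \<^const>\<open>BijGroup\<close>, the elements are extensional functions on \<open>U\<close>, so that
  a linear automorphism of \<open>U\<close> is represented by exactly one element.\<close>

definition GL :: "'v::real_vector set \<Rightarrow> ('v \<Rightarrow> 'v) monoid" where
  "GL U = (BijGroup U)\<lparr>carrier := {f \<in> Bij U.
      (\<forall>x\<in>U. \<forall>y\<in>U. f (x + y) = f x + f y) \<and> (\<forall>c. \<forall>x\<in>U. f (c *\<^sub>R x) = c *\<^sub>R f x)}\<rparr>"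

definition reflection :: "'v::real_vector set \<Rightarrow> ('v \<Rightarrow> 'v \<Rightarrow> real) \<Rightarrow> 'v \<Rightarrow> 'v \<Rightarrow> 'v" where
  "reflection U b \<alpha> = (\<lambda>v\<in>U. v - (2 * b \<alpha> v / b \<alpha> \<alpha>) *\<^sub>R \<alpha>)"

definition reflection_group ::
    "'v::real_vector set \<Rightarrow> ('v \<Rightarrow> 'v \<Rightarrow> real) \<Rightarrow> 'v set \<Rightarrow> ('v \<Rightarrow> 'v) monoid" where
  "reflection_group U b R = subgroup_generated (GL U) (reflection U b ` R)"

text \<open>The signature is read off an orthogonal basis; by Sylvester's law of inertia it does not
  depend on the choice of this basis.\<close>

definition has_signature ::
    "'v::real_vector set \<Rightarrow> ('v \<Rightarrow> 'v \<Rightarrow> real) \<Rightarrow> nat \<Rightarrow> nat \<Rightarrow> nat \<Rightarrow> bool" where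
  "has_signature U b npos nneg nzero \<longleftrightarrow>
     (\<exists>C. finite C \<and> independent C \<and> span C = U \<and> pairwise (\<lambda>x y. b x y = 0) C \<and>
        card {c \<in> C. b c c > 0} = npos \<and>
        card {c \<in> C. b c c < 0} = nneg \<and>
        card {c \<in> C. b c c = 0} = nzero)"


section \<open>The extended space\<close>

text \<open>\<open>V1\<close> and \<open>V1s\<close> are the vertices $1$ and $1^*$, and \<open>Arm i j\<close> is $(i,j)$.  \<open>Aux\<close> is not a
  vertex: it only labels the additional basis vector $a'$ of the hyperbolic cover, so that the
  extended space is literally a subspace of its cover.\<close>

datatype label = V1 | V1s | Arm nat nat | Aux

type_synonym coords = "label \<Rightarrow>\<^sub>0 real"

definition vertices :: "nat \<Rightarrow> (nat \<Rightarrow> nat) \<Rightarrow> label set" where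
  "vertices r p = {V1, V1s} \<union> {Arm i j | i j. 1 \<le> i \<and> i \<le> r \<and> 1 \<le> j \<and> j \<le> p i}"

inductive single_edge :: "label \<Rightarrow> label \<Rightarrow> bool" where
  arm: "single_edge (Arm i j) (Arm i (Suc j))"
| hub: "single_edge V1 (Arm i 1)"
| hub_star: "single_edge V1s (Arm i 1)"
| sym: "single_edge \<nu> \<mu> \<Longrightarrow> single_edge \<mu> \<nu>"

definition gram :: "label \<Rightarrow> label \<Rightarrow> real" where
  "gram \<nu> \<mu> = (if \<nu> = \<mu> \<or> {\<nu>, \<mu>} = {V1, V1s} then 2 else if single_edge \<nu> \<mu> then -1 else 0)"

definition simple_root :: "label \<Rightarrow> coords" where
  "simple_root \<nu> = Poly_Mapping.single \<nu> 1"

definition simple_roots :: "nat \<Rightarrow> (nat \<Rightarrow> nat) \<Rightarrow> coords set" where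
  "simple_roots r p = simple_root ` vertices r p"

definition ext_space :: "nat \<Rightarrow> (nat \<Rightarrow> nat) \<Rightarrow> coords set" where
  "ext_space r p = span (simple_roots r p)"

definition ext_form ::
    "nat \<Rightarrow> (nat \<Rightarrow> nat) \<Rightarrow> coords \<Rightarrow> coords \<Rightarrow> real" where
  "ext_form r p x y = (\<Sum>\<nu>\<in>vertices r p. \<Sum>\<mu>\<in>vertices r p.
      Poly_Mapping.lookup x \<nu> * Poly_Mapping.lookup y \<mu> * gram \<nu> \<mu>)"

definition ext_weyl_group ::
    "nat \<Rightarrow> (nat \<Rightarrow> nat) \<Rightarrow> (coords \<Rightarrow> coords) monoid" where
  "ext_weyl_group r p = reflection_group (ext_space r p) (ext_form r p) (simple_roots r p)"

definition wild :: "nat \<Rightarrow> (nat \<Rightarrow> nat) \<Rightarrow> bool" where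
  "wild r p \<longleftrightarrow>
     has_signature (ext_space r p) (ext_form r p) (card (simple_roots r p) - 2) 1 1"

definition domestic :: "nat \<Rightarrow> (nat \<Rightarrow> nat) \<Rightarrow> bool" where
  "domestic r p \<longleftrightarrow>
     has_signature (ext_space r p) (ext_form r p) (card (simple_roots r p) - 1) 0 1"


section \<open>The hyperbolic cover\<close>

definition radical_root :: coords where
  "radical_root = simple_root V1s - simple_root V1"

definition reduced_space :: "nat \<Rightarrow> (nat \<Rightarrow> nat) \<Rightarrow> coords set" where
  "reduced_space r p = span (simple_roots r p - {simple_root V1s})"

definition aux_vector :: coords where
  "aux_vector = Poly_Mapping.single Aux 1"

definition hyp_space :: "nat \<Rightarrow> (nat \<Rightarrow> nat) \<Rightarrow> coords set" where
  "hyp_space r p = {v + c *\<^sub>R aux_vector | v c. v \<in> ext_space r p}"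

text \<open>The linear form $(\,\cdot\mid a')$ on the extended space vanishes on the reduced space and is
  $1$ on $a$.  It is therefore the coefficient at $\alpha_{1^*}$.  The lemmas \<open>hyp_form_ext\<close>
  to \<open>hyp_form_unique\<close> below show that this is the unique bilinear
  extension with $(\overline V\mid a')=0$, $(a\mid a')=1$ and $(a'\mid a')=0$.\<close>

definition hyp_form ::
    "nat \<Rightarrow> (nat \<Rightarrow> nat) \<Rightarrow> coords \<Rightarrow> coords \<Rightarrow> real" where
  "hyp_form r p x y = ext_form r p x y
     + Poly_Mapping.lookup x V1s * Poly_Mapping.lookup y Aux
     + Poly_Mapping.lookup x Aux * Poly_Mapping.lookup y V1s"

definition hyp_cover ::
    "nat \<Rightarrow> (nat \<Rightarrow> nat) \<Rightarrow> (coords \<Rightarrow> coords) monoid" where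
  "hyp_cover r p = reflection_group (hyp_space r p) (hyp_form r p) (simple_roots r p)"


section \<open>Basic properties\<close>

lemma GL_simps [simp]:
  "carrier (GL U) = {f \<in> Bij U.
      (\<forall>x\<in>U. \<forall>y\<in>U. f (x + y) = f x + f y) \<and> (\<forall>c. \<forall>x\<in>U. f (c *\<^sub>R x) = c *\<^sub>R f x)}"
  by (simp add: GL_def)

lemma subgroup_GL:
  assumes U: "subspace U"
  shows "subgroup (carrier (GL U)) (BijGroup U)"
proof (rule group.subgroupI [OF group_BijGroup])
  show "carrier (GL U) \<subseteq> carrier (BijGroup U)"
    by (auto simp: BijGroup_def)
  have "(\<lambda>x\<in>U. x) \<in> carrier (GL U)"
    using U by (auto simp: id_Bij subspace_add subspace_scale)
  then show "carrier (GL U) \<noteq> {}" by blast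
next
  fix f assume f: "f \<in> carrier (GL U)"
  let ?g = "\<lambda>x\<in>U. inv_into U f x"
  have fB: "f \<in> Bij U" using f by simp
  have bij: "bij_betw f U U" using fB by (simp add: Bij_def)
  have inU: "inv_into U f x \<in> U" if "x \<in> U" for x
    using Bij_inv_into_mem [OF fB that] .
  have ff: "f (inv_into U f x) = x" if "x \<in> U" for x
    using bij that by (simp add: bij_betw_inv_into_right)
  have inj: "inv_into U f y = x" if "f x = y" "x \<in> U" for x y
    using bij that by (metis bij_betw_inv_into_left)
  have "?g (x + y) = ?g x + ?g y" if "x \<in> U" "y \<in> U" for x y
    using f inU U that by (simp add: subspace_add ff inj)
  moreover have "?g (c *\<^sub>R x) = c *\<^sub>R ?g x" if "x \<in> U" for c x
    using f inU U that by (simp add: subspace_scale ff inj)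
  ultimately have "?g \<in> carrier (GL U)"
    using restrict_inv_into_Bij [OF fB] unfolding GL_simps by blast
  then show "inv\<^bsub>BijGroup U\<^esub> f \<in> carrier (GL U)"
    by (simp add: inv_BijGroup [OF fB])
next
  fix f g assume f: "f \<in> carrier (GL U)" and g: "g \<in> carrier (GL U)"
  have mem: "g x \<in> U" if "x \<in> U" for x
    using g that by (auto simp: Bij_def bij_betw_def)
  show "f \<otimes>\<^bsub>BijGroup U\<^esub> g \<in> carrier (GL U)"
    using f g U mem
    by (auto simp: BijGroup_def compose_Bij compose_eq subspace_add subspace_scale)
qed

lemma group_GL: "subspace U \<Longrightarrow> group (GL U)"
  using subgroup.subgroup_is_group [OF subgroup_GL group_BijGroup] by (simp add: GL_def)

lemma lookup_scaleR [simp]: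
  fixes x :: "'a \<Rightarrow>\<^sub>0 real"
  shows "Poly_Mapping.lookup (c *\<^sub>R x) i = c * Poly_Mapping.lookup x i"
proof -
  have "finite {i. c *\<^sub>R Poly_Mapping.lookup x i \<noteq> 0}"
    by (rule finite_subset [OF _ finite_lookup [of x]]) auto
  then show ?thesis by (simp add: scaleR_poly_mapping_def)
qed

lemma finite_vertices [simp]: "finite (vertices r p)"
proof -
  have "vertices r p \<subseteq> {V1, V1s} \<union> (\<lambda>(i, j). Arm i j) ` (SIGMA i:{..r}. {..p i})"
    by (auto simp: vertices_def)
  then show ?thesis by (rule finite_subset) auto
qed

lemma single_edge_sym: "single_edge \<nu> \<mu> \<longleftrightarrow> single_edge \<mu> \<nu>"
  by (blast intro: single_edge.sym)

lemma gram_sym: "gram \<nu> \<mu> = gram \<mu> \<nu>"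
  by (auto simp: gram_def single_edge_sym insert_commute)

lemma ext_form_sym: "ext_form r p x y = ext_form r p y x"
  unfolding ext_form_def by (subst sum.swap) (simp add: gram_sym mult.commute mult.left_commute)

lemma ext_form_linear: "linear (ext_form r p x)"
  by (rule linearI)
     (simp_all add: ext_form_def lookup_add algebra_simps sum.distrib sum_distrib_left)

lemma simple_root_eq_iff [simp]: "simple_root \<nu> = simple_root \<mu> \<longleftrightarrow> \<nu> = \<mu>"
  by (metis simple_root_def lookup_single_eq lookup_single_not_eq zero_neq_one)

lemma ext_form_simple_root:
  assumes "\<nu> \<in> vertices r p" "\<mu> \<in> vertices r p"
  shows "ext_form r p (simple_root \<nu>) (simple_root \<mu>) = gram \<nu> \<mu>"
proof -
  have "ext_form r p (simple_root \<nu>) (simple_root \<mu>) =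
      (\<Sum>\<nu>'\<in>vertices r p. \<Sum>\<mu>'\<in>vertices r p.
         if \<mu>' = \<mu> then (if \<nu>' = \<nu> then gram \<nu> \<mu> else 0) else 0)"
    unfolding ext_form_def simple_root_def
    by (intro sum.cong refl) (auto simp: lookup_single when_def)
  also have "\<dots> = gram \<nu> \<mu>" using assms by simp
  finally show ?thesis .
qed

lemma independent_simple_roots: "independent (simple_roots r p)"
proof (rule independent_if_scalars_zero)
  show "finite (simple_roots r p)" by (simp add: simple_roots_def)
next
  fix f and x :: coords
  assume eq: "(\<Sum>x\<in>simple_roots r p. f x *\<^sub>R x) = 0" and x: "x \<in> simple_roots r p"
  obtain \<nu> where \<nu>: "\<nu> \<in> vertices r p" "x = simple_root \<nu>"
    using x by (auto simp: simple_roots_def)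
  have inj: "inj_on simple_root (vertices r p)"
    by (simp add: inj_on_def)
  have "0 = Poly_Mapping.lookup (\<Sum>x\<in>simple_roots r p. f x *\<^sub>R x) \<nu>"
    by (simp add: eq)
  also have "\<dots> = (\<Sum>\<mu>\<in>vertices r p. f (simple_root \<mu>) * Poly_Mapping.lookup (simple_root \<mu>) \<nu>)"
    by (simp add: simple_roots_def lookup_sum sum.reindex [OF inj])
  also have "\<dots> = (\<Sum>\<mu>\<in>vertices r p. if \<mu> = \<nu> then f (simple_root \<nu>) else 0)"
    by (intro sum.cong refl) (auto simp: simple_root_def lookup_single when_def)
  also have "\<dots> = f x" using \<nu> by simp
  finally show "f x = 0" by simp
qed

lemma hyp_form_sym: "hyp_form r p x y = hyp_form r p y x"
  by (simp add: hyp_form_def ext_form_sym [of r p x y] mult.commute)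

lemma hyp_form_linear: "linear (hyp_form r p x)"
  by (rule linearI)
     (simp_all add: hyp_form_def linear_add [OF ext_form_linear] linear_scale [OF ext_form_linear]
       lookup_add algebra_simps)

lemma lookup_Aux_ext_space:
  assumes "x \<in> ext_space r p" shows "Poly_Mapping.lookup x Aux = 0"
  using assms unfolding ext_space_def
proof (induction rule: span_induct_alt)
  case base then show ?case by simp
next
  case (step c x y)
  then show ?case
    by (auto simp: lookup_add simple_roots_def simple_root_def vertices_def lookup_single)
qed

lemma hyp_form_ext:
  assumes "x \<in> ext_space r p" "y \<in> ext_space r p"
  shows "hyp_form r p x y = ext_form r p x y"
  using assms by (simp add: hyp_form_def lookup_Aux_ext_space)

lemma ext_form_aux: "ext_form r p x aux_vector = 0"
  unfolding ext_form_def
  by (intro sum.neutral ballI) (auto simp: aux_vector_def vertices_def lookup_single)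

lemma hyp_form_aux: "hyp_form r p x aux_vector = Poly_Mapping.lookup x V1s"
  by (simp add: hyp_form_def ext_form_aux) (simp add: aux_vector_def lookup_single)

lemma hyp_form_reduced_aux:
  assumes "x \<in> reduced_space r p" shows "hyp_form r p x aux_vector = 0"
  using assms unfolding reduced_space_def
proof (induction rule: span_induct_alt)
  case base then show ?case by (simp add: hyp_form_aux)
next
  case (step c x y)
  then obtain \<nu> where "x = simple_root \<nu>" "\<nu> \<noteq> V1s" by (auto simp: simple_roots_def)
  then show ?case
    using step by (simp add: hyp_form_aux lookup_add) (simp add: simple_root_def lookup_single)
qed

lemma hyp_form_radical_aux: "hyp_form r p radical_root aux_vector = 1"
  by (simp add: hyp_form_aux radical_root_def simple_root_def lookup_minus lookup_single)

lemma hyp_form_aux_aux: "hyp_form r p aux_vector aux_vector = 0"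
  by (simp add: hyp_form_aux) (simp add: aux_vector_def lookup_single)

lemma simple_root_in_ext_space:
  "\<alpha> \<in> simple_roots r p \<Longrightarrow> \<alpha> \<in> ext_space r p"
  by (simp add: ext_space_def span_base)

lemma ext_space_decomp:
  assumes "v \<in> ext_space r p"
  obtains u c where "u \<in> reduced_space r p" "v = u + c *\<^sub>R radical_root"
proof -
  have V1: "simple_root V1 \<in> reduced_space r p"
    unfolding reduced_space_def
    by (rule span_base) (auto simp: simple_roots_def vertices_def)
  have "insert (simple_root V1s) (simple_roots r p - {simple_root V1s}) = simple_roots r p"
    by (auto simp: simple_roots_def vertices_def)
  then obtain c where c: "v - c *\<^sub>R simple_root V1s \<in> reduced_space r p"
    using assms unfolding ext_space_def reduced_space_def by (metis span_breakdown_eq)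
  have "v - c *\<^sub>R radical_root = (v - c *\<^sub>R simple_root V1s) + c *\<^sub>R simple_root V1"
    by (simp add: radical_root_def algebra_simps)
  then have "v - c *\<^sub>R radical_root \<in> reduced_space r p"
    using c V1 unfolding reduced_space_def by (simp only: span_add span_scale)
  then show ?thesis by (rule that [of _ c]) simp
qed

lemma hyp_form_unique:
  assumes lin: "\<And>x. linear (b x)" and sym: "\<And>x y. b x y = b y x"
    and ext: "\<And>x y. x \<in> ext_space r p \<Longrightarrow> y \<in> ext_space r p \<Longrightarrow> b x y = ext_form r p x y"
    and red: "\<And>x. x \<in> reduced_space r p \<Longrightarrow> b x aux_vector = 0"
    and rad: "b radical_root aux_vector = 1" and aux: "b aux_vector aux_vector = 0"
    and x: "x \<in> hyp_space r p" and y: "y \<in> hyp_space r p"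
  shows "b x y = hyp_form r p x y"
proof -
  have lin2: "linear (\<lambda>z. b z w)" "linear (\<lambda>z. hyp_form r p z w)" for w
    using lin [of w] hyp_form_linear [of r p w]
    by (simp_all add: sym [of _ w] hyp_form_sym [of r p _ w])
  have va: "b v aux_vector = hyp_form r p v aux_vector" if v: "v \<in> ext_space r p" for v
  proof -
    obtain u c where u: "u \<in> reduced_space r p" "v = u + c *\<^sub>R radical_root"
      using v by (rule ext_space_decomp)
    then show ?thesis
      by (simp add: linear_add [OF lin2(1)] linear_scale [OF lin2(1)] linear_add [OF lin2(2)]
          linear_scale [OF lin2(2)] red rad hyp_form_reduced_aux hyp_form_radical_aux)
  qed
  obtain v c w d where v: "v \<in> ext_space r p" "x = v + c *\<^sub>R aux_vector"
    and w: "w \<in> ext_space r p" "y = w + d *\<^sub>R aux_vector"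
    using x y by (auto simp: hyp_space_def)
  have "b aux_vector w = hyp_form r p aux_vector w"
    using va [OF w(1)] sym hyp_form_sym by metis
  then show ?thesis
    using v w
    by (simp add: linear_add [OF lin2(1)] linear_scale [OF lin2(1)] linear_add [OF lin2(2)]
        linear_scale [OF lin2(2)] linear_add [OF lin] linear_scale [OF lin]
        linear_add [OF hyp_form_linear] linear_scale [OF hyp_form_linear]
        va ext hyp_form_ext aux hyp_form_aux_aux)
qed

text \<open>The generating reflections lie in the ambient groups, so the intersection with the carrier
  built into \<^const>\<open>subgroup_generated\<close> does not remove any of them.\<close>

lemma reflection_in_GL:
  assumes U: "subspace U" and \<alpha>: "\<alpha> \<in> U" "b \<alpha> \<alpha> \<noteq> 0" and lin: "linear (b \<alpha>)"
  shows "reflection U b \<alpha> \<in> carrier (GL U)"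
proof -
  let ?s = "reflection U b \<alpha>"
  have mem: "?s v \<in> U" if "v \<in> U" for v
    using that U \<alpha> by (simp add: reflection_def subspace_diff subspace_scale)
  have invol: "?s (?s v) = v" if "v \<in> U" for v
    using that mem [OF that] \<alpha>(2)
    by (simp add: reflection_def linear_diff [OF lin] linear_scale [OF lin] algebra_simps
        flip: scaleR_add_left)
  have "bij_betw ?s U U"
    by (rule bij_betw_byWitness [where f' = ?s]) (auto simp: mem invol)
  moreover have "?s \<in> extensional U" by (simp add: reflection_def)
  moreover have "?s (x + y) = ?s x + ?s y" if "x \<in> U" "y \<in> U" for x y
    using that U by (simp add: reflection_def subspace_add linear_add [OF lin] algebra_simps
        add_divide_distrib)
  moreover have "?s (c *\<^sub>R x) = c *\<^sub>R ?s x" if "x \<in> U" for x c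
    using that U by (simp add: reflection_def subspace_scale linear_scale [OF lin] algebra_simps)
  ultimately show ?thesis by (simp add: Bij_def)
qed

lemma subspace_ext_space: "subspace (ext_space r p)"
  by (simp add: ext_space_def)

lemma hyp_space_span: "hyp_space r p = span (insert aux_vector (simple_roots r p))"
proof (unfold span_insert, intro Set.set_eqI iffI)
  fix x assume "x \<in> hyp_space r p"
  then obtain v c where "v \<in> ext_space r p" "x = v + c *\<^sub>R aux_vector"
    by (auto simp: hyp_space_def)
  then show "x \<in> {x. \<exists>k. x - k *\<^sub>R aux_vector \<in> span (simple_roots r p)}"
    by (auto simp: ext_space_def intro!: exI [of _ c])
next
  fix x assume "x \<in> {x. \<exists>k. x - k *\<^sub>R aux_vector \<in> span (simple_roots r p)}"
  then obtain k where "x - k *\<^sub>R aux_vector \<in> ext_space r p" by (auto simp: ext_space_def)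
  moreover have "x = (x - k *\<^sub>R aux_vector) + k *\<^sub>R aux_vector" by simp
  ultimately show "x \<in> hyp_space r p" unfolding hyp_space_def by blast
qed

lemma subspace_hyp_space: "subspace (hyp_space r p)"
  by (simp add: hyp_space_span)

lemma ext_form_simple_root_self:
  "\<alpha> \<in> simple_roots r p \<Longrightarrow> ext_form r p \<alpha> \<alpha> = 2"
  by (auto simp: simple_roots_def ext_form_simple_root gram_def)

lemma ext_reflections_in_GL:
  "reflection (ext_space r p) (ext_form r p) ` simple_roots r p \<subseteq> carrier (GL (ext_space r p))"
  using reflection_in_GL [OF subspace_ext_space] ext_form_linear simple_root_in_ext_space
    ext_form_simple_root_self by (metis image_subsetI zero_neq_numeral)

lemma hyp_reflections_in_GL:
  "reflection (hyp_space r p) (hyp_form r p) ` simple_roots r p \<subseteq> carrier (GL (hyp_space r p))"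
proof (rule image_subsetI)
  fix \<alpha> assume \<alpha>: "\<alpha> \<in> simple_roots r p"
  show "reflection (hyp_space r p) (hyp_form r p) \<alpha> \<in> carrier (GL (hyp_space r p))"
  proof (rule reflection_in_GL [OF subspace_hyp_space _ _ hyp_form_linear])
    show "\<alpha> \<in> hyp_space r p" using \<alpha> by (simp add: hyp_space_span span_base)
    show "hyp_form r p \<alpha> \<alpha> \<noteq> 0"
      using \<alpha> by (simp add: hyp_form_ext simple_root_in_ext_space ext_form_simple_root_self)
  qed
qed

end

theory Submission
  imports Defs
begin

text \<open>
  An element \<open>w\<close> of the hyperbolic cover is an isometry of the cover.  If it fixes $V$ pointwise,
  then $u = w a' - a'$ is orthogonal to $V = wV$.  Orthogonality to $a$ puts $u$ into $V$, hence
  into the radical of the form on $V$.  The signature makes the radical the line through $a$, so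
  $u = ca$, and $0 = (w a' \mid w a') = 2c$ forces $u = 0$.  Restriction to $V$ maps the
  generating reflections of the cover to those of the extended Weyl group, so being injective it
  is an isomorphism.
\<close>

section \<open>Linear groups, isometries and restriction to a stable subspace\<close>

lemma GL_mem: "f \<in> carrier (GL U) \<Longrightarrow> x \<in> U \<Longrightarrow> f x \<in> U"
  by (auto simp: Bij_def bij_betw_def)

lemma GL_mult:
  "f \<in> carrier (GL U) \<Longrightarrow> g \<in> carrier (GL U) \<Longrightarrow> f \<otimes>\<^bsub>GL U\<^esub> g = compose U f g"
  unfolding GL_simps by (simp add: GL_def BijGroup_def)

lemma GL_one: "\<one>\<^bsub>GL U\<^esub> = (\<lambda>x\<in>U. x)"
  by (simp add: GL_def BijGroup_def)

text \<open>Group actions are homomorphisms into \<open>BijGroup\<close>, while restriction to V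
  naturally lands in \<open>GL\<close>. The two monoids share their multiplication.\<close>

lemma hom_GL_imp_hom_BijGroup:
  assumes "h \<in> hom G (GL U)" shows "h \<in> hom G (BijGroup U)"
  using assms unfolding hom_def by (auto simp: GL_def BijGroup_def)

text \<open>Stability of V is built in so that restriction to V makes sense. Equality of V with its
  image, rather than inclusion, gives closure under inverses and bijective restrictions without a
  dimension count.\<close>

definition isometries ::
    "'v::real_vector set \<Rightarrow> ('v \<Rightarrow> 'v \<Rightarrow> real) \<Rightarrow> 'v set \<Rightarrow> ('v \<Rightarrow> 'v) set" where
  "isometries U b V =
     {f \<in> carrier (GL U). (\<forall>x\<in>U. \<forall>y\<in>U. b (f x) (f y) = b x y) \<and> f ` V = V}"

text \<open>Reduces statements about a whole reflection group to its generators: once these are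
  isometries stabilising V, so is everything they generate.\<close>

lemma subgroup_isometries:
  assumes U: "subspace U" and VU: "V \<subseteq> U"
  shows "subgroup (isometries U b V) (GL U)"
proof -
  interpret group "GL U" using U by (rule group_GL)
  show ?thesis
  proof (rule subgroupI)
    show "isometries U b V \<subseteq> carrier (GL U)" by (auto simp: isometries_def simp del: GL_simps)
    have "\<one>\<^bsub>GL U\<^esub> ` V = V"
      using VU by (force simp: GL_one)
    then have "\<one>\<^bsub>GL U\<^esub> \<in> isometries U b V"
      using one_closed by (simp add: isometries_def GL_one del: GL_simps)
    then show "isometries U b V \<noteq> {}" by blast
  next
    fix f assume f: "f \<in> isometries U b V"
    let ?g = "inv\<^bsub>GL U\<^esub> f"
    have fc: "f \<in> carrier (GL U)" using f by (simp add: isometries_def del: GL_simps)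
    have gc: "?g \<in> carrier (GL U)" using fc by (rule inv_closed)
    have fg: "f (?g x) = x" if "x \<in> U" for x
      using r_inv [OF fc] that by (simp only: GL_mult [OF fc gc] GL_one) (metis compose_eq restrict_apply')
    have gf: "?g (f x) = x" if "x \<in> U" for x
      using l_inv [OF fc] that by (simp only: GL_mult [OF gc fc] GL_one) (metis compose_eq restrict_apply')
    have "b (?g x) (?g y) = b x y" if "x \<in> U" "y \<in> U" for x y
    proof -
      have "b (?g x) (?g y) = b (f (?g x)) (f (?g y))"
        using f GL_mem [OF gc] that by (simp add: isometries_def del: GL_simps)
      then show ?thesis using fg that by simp
    qed
    moreover have "?g ` V = V"
    proof -
      have "?g ` V = ?g ` f ` V" using f by (simp add: isometries_def)
      also have "\<dots> = V" using gf VU by (force simp: image_image)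
      finally show ?thesis .
    qed
    ultimately show "?g \<in> isometries U b V"
      using gc by (simp add: isometries_def del: GL_simps)
  next
    fix f g assume f: "f \<in> isometries U b V" and g: "g \<in> isometries U b V"
    have fc: "f \<in> carrier (GL U)" and gc: "g \<in> carrier (GL U)"
      using f g by (simp_all add: isometries_def del: GL_simps)
    have "compose U f g ` V = f ` g ` V"
      using VU by (force simp: compose_eq)
    then have "compose U f g ` V = V" using f g by (simp add: isometries_def)
    then show "f \<otimes>\<^bsub>GL U\<^esub> g \<in> isometries U b V"
      using f g m_closed [OF fc gc] GL_mem [OF gc]
      by (simp add: isometries_def GL_mult [OF fc gc] compose_eq del: GL_simps)
  qed
qed

text \<open>Restriction respects composition because the inner factor maps V into V; hence the
  domain is the stabiliser and not all of \<open>GL U\<close>.\<close>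

lemma restrict_hom_isometries:
  assumes U: "subspace U" and V: "subspace V" and VU: "V \<subseteq> U"
  shows "(\<lambda>f. restrict f V) \<in> hom ((GL U)\<lparr>carrier := isometries U b V\<rparr>) (GL V)"
proof -
  have mem: "restrict f V \<in> carrier (GL V)" if f: "f \<in> isometries U b V" for f
  proof -
    have im: "f ` V = V" and bij: "bij_betw f U U"
      and lin: "\<And>x y. x \<in> U \<Longrightarrow> y \<in> U \<Longrightarrow> f (x + y) = f x + f y"
        "\<And>c x. x \<in> U \<Longrightarrow> f (c *\<^sub>R x) = c *\<^sub>R f x"
      using f by (auto simp: isometries_def Bij_def)
    have "bij_betw f V V"
      using bij im VU by (metis bij_betw_def inj_on_subset)
    then have "restrict f V \<in> Bij V" by (simp add: Bij_def cong: bij_betw_cong)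
    then show ?thesis
      using lin VU V by (auto simp: subspace_add subspace_scale subset_iff)
  qed
  show ?thesis
  proof (rule homI)
    fix f assume "f \<in> carrier ((GL U)\<lparr>carrier := isometries U b V\<rparr>)"
    then show "restrict f V \<in> carrier (GL V)" using mem by simp
  next
    fix f g assume "f \<in> carrier ((GL U)\<lparr>carrier := isometries U b V\<rparr>)"
      and "g \<in> carrier ((GL U)\<lparr>carrier := isometries U b V\<rparr>)"
    then have f: "f \<in> isometries U b V" and g: "g \<in> isometries U b V" by simp_all
    have fc: "f \<in> carrier (GL U)" and gc: "g \<in> carrier (GL U)"
      using f g by (simp_all add: isometries_def del: GL_simps)
    have "g x \<in> V" if "x \<in> V" for x
      using g that by (auto simp: isometries_def)
    then have "restrict (compose U f g) V = compose V (restrict f V) (restrict g V)"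
      using VU by (auto simp: compose_def fun_eq_iff restrict_def)
    then show "restrict (f \<otimes>\<^bsub>(GL U)\<lparr>carrier := isometries U b V\<rparr>\<^esub> g) V =
        restrict f V \<otimes>\<^bsub>GL V\<^esub> restrict g V"
      by (simp add: GL_mult [OF fc gc] GL_mult [OF mem [OF f] mem [OF g]])
  qed
qed

text \<open>V is stable because a vector and its mirror image differ by a multiple of \<alpha>,
  which lies in V.\<close>

lemma reflection_in_isometries:
  assumes U: "subspace U" and V: "subspace V" and VU: "V \<subseteq> U"
    and \<alpha>: "\<alpha> \<in> V" "b \<alpha> \<alpha> \<noteq> 0"
    and lin: "\<And>x. linear (b x)" and sym: "\<And>x y. b x y = b y x"
  shows "reflection U b \<alpha> \<in> isometries U b V"
proof -
  let ?s = "reflection U b \<alpha>"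
  have lin2: "linear (\<lambda>z. b z w)" for w
    using lin [of w] by (simp add: sym [of _ w])
  have "\<alpha> \<in> U" using \<alpha> VU by blast
  then have "?s \<in> carrier (GL U)" using U \<alpha>(2) lin by (intro reflection_in_GL)
  moreover have "b (?s x) (?s y) = b x y" if "x \<in> U" "y \<in> U" for x y
    using that \<alpha>(2) sym [of x \<alpha>]
    by (simp add: reflection_def linear_diff [OF lin] linear_scale [OF lin]
        linear_diff [OF lin2] linear_scale [OF lin2] field_simps)
  moreover have "?s ` V = V"
  proof -
    have "?s v = v - (2 * b \<alpha> v / b \<alpha> \<alpha>) *\<^sub>R \<alpha>" if "v \<in> V" for v
      using that VU by (auto simp: reflection_def)
    \<comment> \<open>On V the map agrees with the reflection of V itself, which is already known to
      be a bijection of V.\<close>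
    then have "?s v = reflection V b \<alpha> v" if "v \<in> V" for v
      using that by (simp add: reflection_def)
    then have "?s ` V = reflection V b \<alpha> ` V" by simp
    also have "\<dots> = V"
      using reflection_in_GL [of V \<alpha> b] V \<alpha> lin by (simp add: Bij_def bij_betw_def)
    finally show ?thesis .
  qed
  ultimately show ?thesis by (simp add: isometries_def del: GL_simps)
qed

lemma restrict_reflection:
  assumes "V \<subseteq> U" "\<And>v. v \<in> V \<Longrightarrow> b \<alpha> v = b' \<alpha> v" "b \<alpha> \<alpha> = b' \<alpha> \<alpha>"
  shows "restrict (reflection U b \<alpha>) V = reflection V b' \<alpha>"
  using assms by (auto simp: reflection_def fun_eq_iff restrict_def)

section \<open>The radical of the extended form\<close>

text \<open>In an orthogonal basis a radical vector has coordinate zero at every non-isotropic basis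
  vector. Nullity one leaves a single basis vector \<open>d\<close>, so the radical lies on one
  line.\<close>

lemma radical_one_dimensional:
  assumes sig: "has_signature U b m n 1" and lin: "\<And>x. linear (b x)"
    and a: "a \<in> U" "a \<noteq> 0" "\<And>x. x \<in> U \<Longrightarrow> b x a = 0"
    and u: "u \<in> U" "\<And>x. x \<in> U \<Longrightarrow> b x u = 0"
  obtains c where "u = c *\<^sub>R a"
proof -
  obtain C where C: "finite C" "span C = U" "pairwise (\<lambda>x y. b x y = 0) C"
    and card: "card {c \<in> C. b c c = 0} = 1"
    using sig unfolding has_signature_def by blast
  obtain d where d: "{c \<in> C. b c c = 0} = {d}"
    using card card_1_singletonE by blast
  have line: "\<exists>k. v = k *\<^sub>R d" if v: "v \<in> U" "\<And>x. x \<in> U \<Longrightarrow> b x v = 0" for v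
  proof -
    obtain f where f: "v = (\<Sum>c\<in>C. f c *\<^sub>R c)"
      using v(1) unfolding C(2) [symmetric] span_finite [OF C(1)] by blast
    have "f c = 0" if c: "c \<in> C" "c \<noteq> d" for c
    proof -
      have "c \<in> U" using c C(2) by (auto intro: span_base)
      \<comment> \<open>Pairing with \<open>c\<close> isolates the coefficient \<open>f c\<close>,
        multiplied by \<open>b c c\<close>, which is nonzero since \<open>c\<close> is not
        \<open>d\<close>.\<close>
      then have "0 = b c v" using v(2) by simp
      also have "\<dots> = (\<Sum>e\<in>C. f e * b c e)"
        by (simp add: f linear_sum [OF lin] linear_scale [OF lin])
      also have "\<dots> = (\<Sum>e\<in>C. if e = c then f c * b c c else 0)"
        using C(3) c(1) by (intro sum.cong refl) (auto simp: pairwise_def)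
      also have "\<dots> = f c * b c c" using C(1) c(1) by simp
      finally show ?thesis using d c by auto
    qed
    then have "v = (\<Sum>c\<in>C. if c = d then f d *\<^sub>R d else 0)"
      unfolding f by (intro sum.cong refl) auto
    moreover have "d \<in> C" using d by blast
    ultimately show ?thesis using C(1) by auto
  qed
  obtain k where k: "a = k *\<^sub>R d" using line a by blast
  moreover obtain l where "u = l *\<^sub>R d" using line u by blast
  moreover have "k \<noteq> 0" using a(2) k by auto
  ultimately have "u = (l / k) *\<^sub>R a" by simp
  then show ?thesis by (rule that)
qed

text \<open>The vertices \<open>V1\<close> and \<open>V1s\<close> are twins with the same
  neighbours. Both argument positions are treated at once because the \<open>sym\<close> case of the
  induction swaps them.\<close>

lemma single_edge_hub_imp:
  assumes "single_edge \<nu> \<mu>"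
  shows "(\<nu> = V1 \<longrightarrow> single_edge V1s \<mu>) \<and> (\<nu> = V1s \<longrightarrow> single_edge V1 \<mu>) \<and>
         (\<mu> = V1 \<longrightarrow> single_edge V1s \<nu>) \<and> (\<mu> = V1s \<longrightarrow> single_edge V1 \<nu>)"
  using assms by induction (auto intro: single_edge.intros simp del: One_nat_def)

text \<open>The dotted bond has the same entry 2 as the diagonal, so the twins have equal columns in
  the Gram matrix, and their difference is radical.\<close>

lemma gram_hub: "gram \<nu> V1s = gram \<nu> V1"
proof (cases "\<nu> \<in> {V1, V1s}")
  case True
  then show ?thesis by (auto simp: gram_def)
next
  case False
  then have "{\<nu>, V1s} \<noteq> {V1, V1s}" "{\<nu>, V1} \<noteq> {V1, V1s}"
    by (auto simp: doubleton_eq_iff)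
  moreover have "single_edge \<nu> V1s \<longleftrightarrow> single_edge \<nu> V1"
    using single_edge_hub_imp single_edge_sym by blast
  ultimately show ?thesis using False by (simp add: gram_def)
qed

lemma radical_root_in_ext_space: "radical_root \<in> ext_space r p"
  unfolding radical_root_def ext_space_def
  by (intro span_diff span_base) (auto simp: simple_roots_def vertices_def)

lemma radical_root_nonzero: "radical_root \<noteq> 0"
  by (simp add: radical_root_def)

lemma ext_form_radical_root: "ext_form r p x radical_root = 0"
proof -
  have "(\<Sum>\<mu>\<in>vertices r p. Poly_Mapping.lookup radical_root \<mu> * gram \<nu> \<mu>) = 0" for \<nu>
  proof -
    have "(\<Sum>\<mu>\<in>vertices r p. Poly_Mapping.lookup radical_root \<mu> * gram \<nu> \<mu>) =
        (\<Sum>\<mu>\<in>{V1, V1s}. Poly_Mapping.lookup radical_root \<mu> * gram \<nu> \<mu>)"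
    proof (rule sum.mono_neutral_right)
      show "{V1, V1s} \<subseteq> vertices r p" by (auto simp: vertices_def)
    qed (auto simp: radical_root_def simple_root_def lookup_minus lookup_single)
    also have "\<dots> = 0"
      by (simp add: radical_root_def simple_root_def lookup_minus lookup_single gram_hub)
    finally show ?thesis .
  qed
  then show ?thesis
    by (simp add: ext_form_def mult.assoc flip: sum_distrib_left)
qed

section \<open>The hyperbolic cover and its isometries fixing V\<close>

lemma ext_space_subset_hyp_space: "ext_space r p \<subseteq> hyp_space r p"
  unfolding hyp_space_span ext_space_def by (intro span_mono) auto

lemma aux_vector_in_hyp_space: "aux_vector \<in> hyp_space r p"
  by (simp add: hyp_space_span span_base)

text \<open>Pairing with a reads off the coefficient of a'. With the next lemma, this identifies V
  as the orthogonal complement of a in the cover.\<close>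

lemma hyp_form_radical_root: "hyp_form r p x radical_root = Poly_Mapping.lookup x Aux"
  by (simp add: hyp_form_def ext_form_radical_root)
    (simp add: radical_root_def simple_root_def lookup_minus lookup_single)

lemma hyp_space_lookup_Aux_zero:
  assumes x: "x \<in> hyp_space r p" and "Poly_Mapping.lookup x Aux = 0"
  shows "x \<in> ext_space r p"
proof -
  obtain v c where v: "v \<in> ext_space r p" "x = v + c *\<^sub>R aux_vector"
    using x by (auto simp: hyp_space_def)
  then have "c = 0"
    using assms(2) by (simp add: lookup_add lookup_Aux_ext_space aux_vector_def)
  with v show ?thesis by simp
qed

text \<open>Since V and a' span the cover, only the image of a' has to be determined. The signature
  enters only through its nullity, so the domestic and wild types are handled together.\<close>

lemma hyp_isometry_fixing_ext_space:
  assumes sig: "has_signature (ext_space r p) (ext_form r p) m n 1"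
    and w: "w \<in> isometries (hyp_space r p) (hyp_form r p) V"
    and fixV: "\<And>v. v \<in> ext_space r p \<Longrightarrow> w v = v" and x: "x \<in> hyp_space r p"
  shows "w x = x"
proof -
  let ?b = "hyp_form r p"
  have wc: "w \<in> carrier (GL (hyp_space r p))"
    using w by (simp add: isometries_def del: GL_simps)
  have iso: "?b (w x) (w y) = ?b x y" if "x \<in> hyp_space r p" "y \<in> hyp_space r p" for x y
    using w that by (simp add: isometries_def)
  note aux = aux_vector_in_hyp_space [of r p]
  note VU = subsetD [OF ext_space_subset_hyp_space [of r p]]
  define u where "u = w aux_vector - aux_vector"
  have uU: "u \<in> hyp_space r p"
    unfolding u_def using GL_mem [OF wc aux] aux subspace_hyp_space by (intro subspace_diff)
  \<comment> \<open>As \<open>w\<close> fixes v and is an isometry, v pairs equally with w a' and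
    with a'.\<close>
  have orth: "?b v u = 0" if v: "v \<in> ext_space r p" for v
    using iso [OF VU [OF v] aux] fixV [OF v]
    by (simp add: u_def linear_diff [OF hyp_form_linear])
  have "Poly_Mapping.lookup u Aux = 0"
    using orth [OF radical_root_in_ext_space] hyp_form_radical_root hyp_form_sym by metis
  with uU have uV: "u \<in> ext_space r p" by (rule hyp_space_lookup_Aux_zero)
  have "ext_form r p v u = 0" if "v \<in> ext_space r p" for v
    using orth [OF that] hyp_form_ext [OF that uV] by simp
  then obtain c where c: "u = c *\<^sub>R radical_root"
    using radical_one_dimensional [OF sig ext_form_linear radical_root_in_ext_space
        radical_root_nonzero ext_form_radical_root uV] by blast
  have lin2: "linear (\<lambda>z. ?b z y)" for y
    using hyp_form_linear [of r p y] by (simp add: hyp_form_sym [of r p _ y])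
  have wa: "w aux_vector = aux_vector + c *\<^sub>R radical_root"
    using c by (simp add: u_def algebra_simps)
  \<comment> \<open>Both a and a' are isotropic, so the square of a' + ca consists of the two cross
    terms only.\<close>
  have "?b aux_vector radical_root = 1"
    using hyp_form_radical_aux hyp_form_sym by metis
  moreover have "?b radical_root radical_root = 0"
    by (simp add: hyp_form_radical_root lookup_Aux_ext_space [OF radical_root_in_ext_space])
  ultimately have "?b (w aux_vector) (w aux_vector) = 2 * c"
    by (simp add: wa linear_add [OF hyp_form_linear] linear_scale [OF hyp_form_linear]
        linear_add [OF lin2] linear_scale [OF lin2] hyp_form_radical_aux hyp_form_aux_aux)
  then have "c = 0" using iso [OF aux aux] by (simp add: hyp_form_aux_aux)
  then have wa': "w aux_vector = aux_vector" by (simp add: wa)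
  obtain v k where v: "v \<in> ext_space r p" "x = v + k *\<^sub>R aux_vector"
    using x by (auto simp: hyp_space_def)
  have "k *\<^sub>R aux_vector \<in> hyp_space r p"
    using aux subspace_hyp_space by (intro subspace_scale)
  then show ?thesis
    using wc v VU [OF v(1)] aux by (simp add: fixV wa')
qed

section \<open>Faithfulness on V and the isomorphism by restriction\<close>

theorem proposition4p1:
  fixes r :: nat and p :: "nat \<Rightarrow> nat"
  assumes "\<And>i. 1 \<le> i \<Longrightarrow> i \<le> r \<Longrightarrow> 1 \<le> p i"
    and "domestic r p \<or> wild r p"
  shows "faithful_action (hyp_cover r p) (ext_space r p) (\<lambda>w. restrict w (ext_space r p)) \<and>
         hyp_cover r p \<cong> ext_weyl_group r p"
proof -
  let ?U = "hyp_space r p" and ?V = "ext_space r p" and ?b = "hyp_form r p"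
  let ?h = "\<lambda>w. restrict w ?V" and ?W = "hyp_cover r p"
  let ?I = "isometries ?U ?b ?V" and ?S = "reflection ?U ?b ` simple_roots r p"
  let ?G = "(GL ?U)\<lparr>carrier := ?I\<rparr>"
  note VU = ext_space_subset_hyp_space [of r p]
  obtain m n where sig: "has_signature ?V (ext_form r p) m n 1"
    using assms(2) unfolding domestic_def wild_def by blast
  interpret U: group "GL ?U" by (rule group_GL [OF subspace_hyp_space])
  note subI = subgroup_isometries [OF subspace_hyp_space VU, of ?b]
  have SI: "?S \<subseteq> ?I"
  proof (rule image_subsetI)
    fix \<alpha> assume \<alpha>: "\<alpha> \<in> simple_roots r p"
    then have "?b \<alpha> \<alpha> \<noteq> 0"
      by (simp add: hyp_form_ext simple_root_in_ext_space ext_form_simple_root_self)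
    then show "reflection ?U ?b \<alpha> \<in> ?I"
      using \<alpha> by (intro reflection_in_isometries subspace_hyp_space subspace_ext_space VU
          simple_root_in_ext_space hyp_form_linear hyp_form_sym)
  qed
  have "?I \<subseteq> carrier (GL ?U)" by (rule subgroup.subset [OF subI])
  then have "carrier (GL ?U) \<inter> ?S = ?S"
    using SI by blast
  moreover have "carrier ?G \<inter> ?S = ?S"
    using SI by (simp add: Int_absorb1)
  \<comment> \<open>The generated group is the same whether formed in \<open>GL ?U\<close> or in its
    subgroup \<open>?I\<close>, and restriction is a homomorphism only known on the latter.\<close>
  ultimately have W: "?W = subgroup_generated ?G ?S"
    by (simp add: hyp_cover_def reflection_group_def subgroup_generated_def
        U.generate_consistent [OF SI subI] del: GL_simps)
  interpret h: group_hom ?G "GL ?V" ?h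
    using U.subgroup_imp_group [OF subI] group_GL [OF subspace_ext_space]
      restrict_hom_isometries [OF subspace_hyp_space subspace_ext_space VU]
    by (intro group_hom.intro group_hom_axioms.intro)
  have hS: "?h ` ?S = reflection ?V (ext_form r p) ` simple_roots r p"
  proof -
    have "?h (reflection ?U ?b \<alpha>) = reflection ?V (ext_form r p) \<alpha>"
      if "\<alpha> \<in> simple_roots r p" for \<alpha>
      using that VU by (intro restrict_reflection) (auto simp: hyp_form_ext simple_root_in_ext_space)
    then show ?thesis unfolding image_image by (rule image_cong [OF refl])
  qed
  have ext: "ext_weyl_group r p = subgroup_generated (GL ?V) (?h ` ?S)"
    by (simp only: hS ext_weyl_group_def reflection_group_def)
  have grpW: "group ?W" unfolding W by (rule h.G.group_subgroup_generated)
  have homGL: "?h \<in> hom ?W (GL ?V)"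
    unfolding W by (rule h.G.hom_from_subgroup_generated) (rule h.homh)
  interpret act: group_hom ?W "BijGroup ?V" ?h
    using grpW group_BijGroup hom_GL_imp_hom_BijGroup [OF homGL]
    by (intro group_hom.intro group_hom_axioms.intro)
  have WI: "carrier ?W \<subseteq> ?I"
    using h.G.carrier_subgroup_generated_subset [of ?S] by (simp add: W)
  have inj: "inj_on ?h (carrier ?W)"
    \<comment> \<open>Faithfulness amounts to a trivial kernel: \<open>?h w\<close> being the
      identity says that \<open>w\<close> fixes V pointwise.\<close>
    unfolding act.inj_on_one_iff
  proof (intro allI impI)
    fix w assume wW: "w \<in> carrier ?W" and one: "?h w = \<one>\<^bsub>BijGroup ?V\<^esub>"
    have w: "w \<in> ?I" using wW WI by blast
    have "w v = v" if "v \<in> ?V" for v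
      using fun_cong [OF one, of v] that by (simp add: BijGroup_def)
    then have "w x = x" if "x \<in> ?U" for x
      using hyp_isometry_fixing_ext_space [OF sig w _ that] by blast
    \<comment> \<open>Extensionality settles the values outside \<open>?U\<close>, turning pointwise
      agreement into equality of functions.\<close>
    moreover have "w \<in> extensional ?U"
      using w by (simp add: isometries_def Bij_def)
    ultimately have "w = \<one>\<^bsub>GL ?U\<^esub>"
      by (auto simp: GL_one fun_eq_iff extensional_def)
    then show "w = \<one>\<^bsub>?W\<^esub>" by (simp add: W)
  qed
  have "faithful_action ?W ?V ?h"
    using inj act.group_hom_axioms
    by (intro faithful_action.intro group_action.intro faithful_action_axioms.intro)
  moreover have "?h \<in> iso ?W (ext_weyl_group r p)"
  proof -
    \<comment> \<open>Surjectivity: the image of a generated subgroup is generated by the images of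
      the generators, here the reflections of V.\<close>
    have "?h ` carrier ?W = carrier (ext_weyl_group r p)"
      unfolding W ext using SI by (intro h.subgroup_generated_by_image [symmetric]) simp
    moreover have "?h \<in> hom ?W (ext_weyl_group r p)"
      unfolding W ext by (rule h.hom_between_subgroups) simp
    ultimately show ?thesis using inj by (simp add: iso_def bij_betw_def)
  qed
  ultimately show ?thesis by (auto simp: is_iso_def)
qed

end
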